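(* Let $T=\begin{pmatrix}A&B\\C&D\end{pmatrix}\in\psi(M,N)$. If $\mathcal{R}(C)$ is finite-dimensional and $\mathcal{R}(D)$ is infinite-dimensional, then $T\in\partial\big((\psi(M,N))^{\complement}\big)$, where the boundary is taken with respect to the strong operator topology on $\mathcal{B}(\mathcal{H},\mathcal{K})$.
   Context: $\mathcal{H}$ and $\mathcal{K}$ are real or complex Hilbert spaces, $\mathcal{B}(\mathcal{H},\mathcal{K})$ is the space of bounded linear operators from $\mathcal{H}$ to $\mathcal{K}$, and $\mathcal{B}(\mathcal{H})=\mathcal{B}(\mathcal{H},\mathcal{H})$. $\mathcal{R}(\cdot)$ denotes range and $*$ denotes adjoint. $M\subseteq\mathcal{H}$ and $N\subseteq\mathcal{K}$ are closed subspaces. Block matrices are taken with respect to $\mathcal{H}=M\oplus M^\perp$ and $\mathcal{K}=N\oplus N^\perp$, so $A:M\to N$, $B:M^\perp\to N$, $C:M\to N^\perp$, $D:M^\perp\to N^\perp$. $T\in\mathcal{B}(\mathcal{H},\mathcal{K})$ is $(M,N)$-complementable if there are (bounded, idempotent) projections $P_r\in\mathcal{B}(\mathcal{H})$, $P_\ell\in\mathcal{B}(\mathcal{K})$ with ranges $M$ and $N$ respectively, and operators $M_r\in\mathcal{B}(\mathcal{H})$, $M_\ell\in\mathcal{B}(\mathcal{K})$ with $(I-P_r)M_r=M_r$, $(I-P_\ell)TM_r=(I-P_\ell)T$, $M_\ell(I-P_\ell)=M_\ell$, $M_\ell T(I-P_r)=T(I-P_r)$. It is known that this is equivalent to $\mathcal{R}(C)\subseteq\mathcal{R}(D)$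 and $\mathcal{R}(B^* )\subseteq\mathcal{R}(D^* )$. $\psi(M,N)$ is the set of all $(M,N)$-complementable operators and $(\psi(M,N))^{\complement}$ is its complement in $\mathcal{B}(\mathcal{H},\mathcal{K})$, i.e. the set of operators that are not $(M,N)$-complementable. $\partial$ denotes topological boundary.
   Formalization: Complementability is taken for fixed projections onto M and N (any choice, including the orthogonal ones, which give the range criterion) rather than existentially for each operator, and the case M = N = {0}, where every operator is complementable and the claim fails, is excluded. *)

theory Defs
  imports "HOL-Analysis.Analysis"
begin

(* The two scalar fields at once. The identity star_self forces every element fixed by star
   to be a real multiple of 1 and every scalar to satisfy a real quadratic equation, so up to
   isomorphism the only instances are the real and the complex numbers. *)
class rc_scalar = real_normed_field +
  fixes star :: "'a \<Rightarrow> 'a"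
  assumes star_add: "star (x + y) = star x + star y"
    and star_mult: "star (x * y) = star x * star y"
    and star_star: "star (star x) = x"
    and star_self: "x * star x = (norm x)\<^sup>2 *\<^sub>R 1"

instantiation real :: rc_scalar
begin
definition star_real :: "real \<Rightarrow> real" where "star_real x = x"
instance by standard (auto simp: star_real_def power2_eq_square)
end

instantiation complex :: rc_scalar
begin
definition star_complex :: "complex \<Rightarrow> complex" where "star_complex = cnj"
instance by standard (auto simp: star_complex_def scaleR_conv_of_real complex_norm_square[symmetric])
end

(* Norm, topology and completeness come from the class banach; the last two assumptions tie
   them to the scalar multiplication and to the inner product. *)
locale hilbert_space = vector_space scl
  for scl :: "'f::rc_scalar \<Rightarrow> 'a::banach \<Rightarrow> 'a" +
  fixes ip :: "'a \<Rightarrow> 'a \<Rightarrow> 'f"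
  assumes ip_add_left: "ip (x + y) z = ip x z + ip y z"
    and ip_scale_left: "ip (scl c x) y = c * ip x y"
    and ip_star: "ip y x = star (ip x y)"
    and ip_self: "ip x x = of_real ((norm x)\<^sup>2)"
    and scale_of_real: "scl (of_real r) x = r *\<^sub>R x"

lemma hilbert_space_real:
  "hilbert_space scaleR (inner :: 'a::{real_inner,banach} \<Rightarrow> 'a \<Rightarrow> real)"
  by standard (auto simp: star_real_def inner_add_left inner_commute
      power2_norm_eq_inner algebra_simps)

lemma hilbert_space_complex:
  "hilbert_space (*) (\<lambda>x y :: complex. x * cnj y)"
  by standard (auto simp: star_complex_def algebra_simps scaleR_conv_of_real
      complex_norm_square[symmetric])

definition closed_subspace :: "('f::field \<Rightarrow> 'a::banach \<Rightarrow> 'a) \<Rightarrow> 'a set \<Rightarrow> bool" where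
  "closed_subspace scl S \<longleftrightarrow> module.subspace scl S \<and> closed S"

definition finite_dimensional :: "('f::field \<Rightarrow> 'a::ab_group_add \<Rightarrow> 'a) \<Rightarrow> 'a set \<Rightarrow> bool" where
  "finite_dimensional scl S \<longleftrightarrow> (\<exists>E. finite E \<and> S = module.span scl E)"

definition orth_compl :: "('a \<Rightarrow> 'a \<Rightarrow> 'f::zero) \<Rightarrow> 'a set \<Rightarrow> 'a set" where
  "orth_compl ip S = {x. \<forall>y\<in>S. ip x y = 0}"

definition orth_proj :: "('a::ab_group_add \<Rightarrow> 'a \<Rightarrow> 'f::zero) \<Rightarrow> 'a set \<Rightarrow> 'a \<Rightarrow> 'a" where
  "orth_proj ip S x = (THE y. y \<in> S \<and> x - y \<in> orth_compl ip S)"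

(* The entry X -> Y of the block matrix of T, where Y is a summand of an orthogonal
   decomposition of the codomain; meaningful on X only. *)
definition block :: "('b \<Rightarrow> 'b \<Rightarrow> 'f::zero) \<Rightarrow> 'a set \<Rightarrow> 'b set \<Rightarrow>
    ('a::banach \<Rightarrow>\<^sub>L 'b::banach) \<Rightarrow> 'a \<Rightarrow> 'b" where
  "block ip X Y T = (\<lambda>x\<in>X. orth_proj ip Y (blinfun_apply T x))"

(* Elements of the library's type of bounded operators are only real-linear. *)
definition bounded_operators :: "('f::field \<Rightarrow> 'a::banach \<Rightarrow> 'a) \<Rightarrow>
    ('f \<Rightarrow> 'b::banach \<Rightarrow> 'b) \<Rightarrow> ('a \<Rightarrow>\<^sub>L 'b) set" where
  "bounded_operators scaleH scaleK =
    {T. Vector_Spaces.linear scaleH scaleK (blinfun_apply T)}"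

definition sot :: "('f::field \<Rightarrow> 'a::banach \<Rightarrow> 'a) \<Rightarrow>
    ('f \<Rightarrow> 'b::banach \<Rightarrow> 'b) \<Rightarrow> ('a \<Rightarrow>\<^sub>L 'b) topology" where
  "sot scaleH scaleK =
    subtopology strong_operator_topology (bounded_operators scaleH scaleK)"

definition projection_onto :: "('f::field \<Rightarrow> 'a::banach \<Rightarrow> 'a) \<Rightarrow> 'a set \<Rightarrow>
    ('a \<Rightarrow>\<^sub>L 'a) \<Rightarrow> bool" where
  "projection_onto scl S P \<longleftrightarrow>
    P \<in> bounded_operators scl scl \<and> P o\<^sub>L P = P \<and> range (blinfun_apply P) = S"

(* Complementability is taken with respect to given (possibly oblique) bounded projections
   Pr and Pl onto M and N. They are parameters and not chosen anew for each operator, since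
   the condition does depend on the kernel of Pr. For the orthogonal projections it says
   that the range of C lies in that of D and the range of the adjoint of B in that of the
   adjoint of D; for the map (x,y) |-> x from R^2 to R, with M the first axis and N = 0, the
   first inclusion fails although the four equations are solvable for the projection onto M
   along the diagonal. *)
definition complementable :: "('f::field \<Rightarrow> 'a::banach \<Rightarrow> 'a) \<Rightarrow>
    ('f \<Rightarrow> 'b::banach \<Rightarrow> 'b) \<Rightarrow> ('a \<Rightarrow>\<^sub>L 'a) \<Rightarrow> ('b \<Rightarrow>\<^sub>L 'b) \<Rightarrow>
    ('a \<Rightarrow>\<^sub>L 'b) \<Rightarrow> bool" where
  "complementable scaleH scaleK Pr Pl T \<longleftrightarrow>
    (\<exists>Mr \<in> bounded_operators scaleH scaleH. \<exists>Ml \<in> bounded_operators scaleK scaleK.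
      (id_blinfun - Pr) o\<^sub>L Mr = Mr \<and>
      (id_blinfun - Pl) o\<^sub>L T o\<^sub>L Mr = (id_blinfun - Pl) o\<^sub>L T \<and>
      Ml o\<^sub>L (id_blinfun - Pl) = Ml \<and>
      Ml o\<^sub>L T o\<^sub>L (id_blinfun - Pr) = T o\<^sub>L (id_blinfun - Pr))"

definition psi :: "('f::field \<Rightarrow> 'a::banach \<Rightarrow> 'a) \<Rightarrow>
    ('f \<Rightarrow> 'b::banach \<Rightarrow> 'b) \<Rightarrow> ('a \<Rightarrow>\<^sub>L 'a) \<Rightarrow> ('b \<Rightarrow>\<^sub>L 'b) \<Rightarrow>
    ('a \<Rightarrow>\<^sub>L 'b) set" where
  "psi scaleH scaleK Pr Pl =
    {T \<in> bounded_operators scaleH scaleK. complementable scaleH scaleK Pr Pl T}"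

end

theory Submission imports Defs begin

text \<open>A strong neighbourhood of \<open>T\<close> constrains only finitely many vectors \<open>F\<close>. If \<open>N\<close> contains
  \<open>n \<noteq> 0\<close>, take \<open>u\<close> in the infinite-dimensional complement of \<open>M\<close>, orthogonal to \<open>F\<close>. A rank one
  perturbation along \<open>u\<close> keeps \<open>T\<close> on \<open>F\<close> and sends \<open>u - Pr u\<close> to \<open>n\<close>, which contradicts the
  factorization of \<open>T (I - Pr)\<close> through \<open>I - Pl\<close>. If \<open>N = {0}\<close>, then \<open>M\<close> is nontrivial and the range
  inclusion is destroyed instead.\<close>

section \<open>Inner product calculus over a scalar field with conjugation\<close>

context hilbert_space
begin

lemma ip_minus_left: "ip (x - y) z = ip x z - ip y z"
  using ip_add_left[of "x - y" y z] by simp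

lemma ip_zero_left [simp]: "ip 0 z = 0"
  using ip_minus_left[of z z z] by simp

lemma star_zero [simp]: "star (0 :: 'f) = 0"
  using star_add[of "0 :: 'f" 0] by simp

lemma star_minus: "star (a - b :: 'f) = star a - star b"
  using star_add[of "a - b" b] by simp

lemma star_mult_self: "a * star a = of_real ((norm (a :: 'f))\<^sup>2)"
  by (simp add: star_self of_real_def)

lemma ip_zero_right [simp]: "ip z 0 = 0"
  by (subst ip_star) simp

lemma ip_commute_zero: "ip x y = 0 \<longleftrightarrow> ip y x = 0"
  by (metis ip_star star_zero)

lemma ip_minus_right: "ip z (x - y) = ip z x - ip z y"
  by (metis ip_star ip_minus_left star_minus)

lemma ip_add_right: "ip z (x + y) = ip z x + ip z y"
  by (metis ip_star ip_add_left star_add)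

lemma ip_scale_right: "ip z (scl c x) = star c * ip z x"
  by (metis ip_star ip_scale_left star_mult)

lemma ip_self_eq_0 [simp]: "ip x x = 0 \<longleftrightarrow> x = 0"
  by (simp add: ip_self)

text \<open>The class \<open>banach\<close> gives homogeneity of the norm for real factors only; for
  scalars of the field it is read off from \<open>ip_self\<close> and the conjugation
  identities.\<close>

lemma norm_scale: "norm (scl c x) = norm c * norm x"
proof -
  have "of_real ((norm (scl c x))\<^sup>2) = (c * star c) * ip x x"
    unfolding ip_self[symmetric] by (simp add: ip_scale_left ip_scale_right mult_ac)
  also have "\<dots> = of_real ((norm c * norm x)\<^sup>2)"
    by (simp add: star_mult_self ip_self power_mult_distrib)
  finally have "(norm (scl c x))\<^sup>2 = (norm c * norm x)\<^sup>2"
    using of_real_eq_iff by blast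
  then show ?thesis
    by (simp add: power2_eq_iff_nonneg)
qed

text \<open>Pythagoras for the residual of \<open>x\<close> along \<open>y\<close>. It yields
  Cauchy-Schwarz, and later forces the residual of a nearest point to be orthogonal to the
  subspace.\<close>

lemma norm_minus_component:
  assumes "y \<noteq> 0"
  shows "(norm (x - scl (ip x y / ip y y) y))\<^sup>2 = (norm x)\<^sup>2 - (norm (ip x y) / norm y)\<^sup>2"
proof -
  define c where "c = ip x y / ip y y"
  define z where "z = x - scl c y"
  have zy: "ip z y = 0"
    using assms by (simp add: z_def c_def ip_minus_left ip_scale_left)
  have "of_real ((norm z)\<^sup>2) = ip z x"
    unfolding ip_self[symmetric] by (subst (2) z_def) (simp add: ip_minus_right ip_scale_right zy)
  also have "\<dots> = ip x x - ip x y * star (ip x y) / ip y y"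
    by (simp add: z_def c_def ip_minus_left ip_scale_left flip: ip_star)
  also have "\<dots> = of_real ((norm x)\<^sup>2 - (norm (ip x y) / norm y)\<^sup>2)"
    by (simp add: ip_self star_mult_self power_divide)
  finally show ?thesis
    unfolding z_def c_def using of_real_eq_iff by blast
qed

lemma Cauchy_Schwarz: "norm (ip x y) \<le> norm x * norm y"
proof (cases "y = 0")
  case False
  have "0 \<le> (norm x)\<^sup>2 - (norm (ip x y) / norm y)\<^sup>2"
    unfolding norm_minus_component[OF False, symmetric] by simp
  then have "norm (ip x y) / norm y \<le> norm x"
    by - (rule power2_le_imp_le, simp_all)
  then show ?thesis
    using False by (simp add: divide_le_eq)
qed simp

lemma parallelogram_law:
  fixes x y :: 'a
  shows "(norm (x + y))\<^sup>2 + (norm (x - y))\<^sup>2 = 2 * (norm x)\<^sup>2 + 2 * (norm y)\<^sup>2"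
proof -
  have "of_real ((norm (x + y))\<^sup>2 + (norm (x - y))\<^sup>2) = ip (x + y) (x + y) + ip (x - y) (x - y)"
    by (simp add: ip_self)
  also have "\<dots> = ip x x + ip x x + (ip y y + ip y y)"
    by (simp add: ip_add_left ip_add_right ip_minus_left ip_minus_right)
  also have "\<dots> = of_real (2 * (norm x)\<^sup>2 + 2 * (norm y)\<^sup>2)"
    by (simp add: ip_self)
  finally have "(of_real ((norm (x + y))\<^sup>2 + (norm (x - y))\<^sup>2) :: 'f) =
    of_real (2 * (norm x)\<^sup>2 + 2 * (norm y)\<^sup>2)" .
  then show ?thesis
    using of_real_eq_iff by blast
qed

section \<open>Nearest points and orthogonal projections\<close>

lemma subspace_scaleR: "subspace S \<Longrightarrow> x \<in> S \<Longrightarrow> r *\<^sub>R x \<in> S"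
  by (metis subspace_scale scale_of_real)

lemma subspace_orth_compl: "subspace (orth_compl ip S)"
  by (auto simp: subspace_def orth_compl_def ip_add_left ip_scale_left)

text \<open>A minimizing sequence is Cauchy by the parallelogram law, and its limit stays in the
  closed set \<open>S\<close>.\<close>

lemma nearest_point_exists:
  assumes "closed_subspace scl S"
  shows "\<exists>y\<in>S. \<forall>z\<in>S. norm (x - y) \<le> norm (x - z)"
proof -
  have S: "subspace S" "closed S"
    using assms by (auto simp: closed_subspace_def)
  then have "S \<noteq> {}"
    using subspace_0 by blast
  define d where "d = infdist x S"
  have d: "0 \<le> d" "\<And>z. z \<in> S \<Longrightarrow> d \<le> norm (x - z)"
    using infdist_le[of _ S x] by (auto simp: d_def infdist_nonneg dist_norm)
  \<comment> \<open>The slack is put on the squared distance, the quantity that the parallelogram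
    law handles.\<close>
  have "\<exists>y\<in>S. (norm (x - y))\<^sup>2 < d\<^sup>2 + 1 / real (Suc k)" for k
  proof -
    have "d < sqrt (d\<^sup>2 + 1 / real (Suc k))"
      using d(1) by (intro real_less_rsqrt) simp
    then obtain y where "y \<in> S" "norm (x - y) < sqrt (d\<^sup>2 + 1 / real (Suc k))"
      unfolding d_def infdist_notempty[OF \<open>S \<noteq> {}\<close>]
      by (subst (asm) cINF_less_iff) (auto simp: dist_norm \<open>S \<noteq> {}\<close> intro!: bdd_belowI2[of _ 0])
    moreover from this have "(norm (x - y))\<^sup>2 < (sqrt (d\<^sup>2 + 1 / real (Suc k)))\<^sup>2"
      by (intro power_strict_mono) auto
    ultimately show ?thesis
      by (auto intro!: bexI[of _ y])
  qed
  then obtain y where y: "\<And>k. y k \<in> S" "\<And>k. (norm (x - y k))\<^sup>2 < d\<^sup>2 + 1 / real (Suc k)"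
    by metis
  \<comment> \<open>The midpoint of \<open>y m\<close> and \<open>y n\<close> lies in
    \<open>S\<close>, hence has distance at least \<open>d\<close> from \<open>x\<close>. In the
    parallelogram law the terms in \<open>d\<close> cancel and four times the slack remains.\<close>
  have gap: "(norm (y m - y n))\<^sup>2 < 4 / real (Suc k)" if "m \<ge> k" "n \<ge> k" for m n k
  proof -
    have "(1/2) *\<^sub>R (y m + y n) \<in> S"
      using S(1) y(1) by (intro subspace_scaleR subspace_add)
    then have "d \<le> norm (x - (1/2) *\<^sub>R (y m + y n))"
      by (rule d(2))
    also have "\<dots> = norm ((1/2) *\<^sub>R ((x - y m) + (x - y n)))"
      by (rule arg_cong[where f = norm]) (simp add: algebra_simps flip: scaleR_add_left)
    finally have "2 * d \<le> norm ((x - y m) + (x - y n))"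
      by simp
    then have mid: "4 * d\<^sup>2 \<le> (norm ((x - y m) + (x - y n)))\<^sup>2"
      using d(1) power_mono[of "2 * d" _ 2] by (simp add: power_mult_distrib)
    have near: "(norm (x - y j))\<^sup>2 < d\<^sup>2 + 1 / real (Suc k)" if "j \<ge> k" for j
      using y(2)[of j] frac_le[of 1 1 "real (Suc k)" "real (Suc j)"] that by simp
    have "(norm (y m - y n))\<^sup>2 = (norm ((x - y m) - (x - y n)))\<^sup>2"
      by (simp add: norm_minus_commute)
    also have "\<dots> < 4 * (1 / real (Suc k))"
      using mid parallelogram_law[of "x - y m" "x - y n"] near[OF that(1)] near[OF that(2)]
      by linarith
    finally show ?thesis
      by simp
  qed
  have "Cauchy y"
  proof (rule metric_CauchyI)
    fix e :: real assume "0 < e"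
    then obtain k where "4 / e\<^sup>2 < real k"
      using reals_Archimedean2 by blast
    then have "4 / real (Suc k) < e\<^sup>2"
      using \<open>0 < e\<close> by (simp add: field_simps) (smt (verit) zero_less_power)
    then show "\<exists>k. \<forall>m\<ge>k. \<forall>n\<ge>k. dist (y m) (y n) < e"
      using gap \<open>0 < e\<close> unfolding dist_norm
      by (meson less_imp_le less_trans power2_less_imp_less)
  qed
  then obtain l where l: "y \<longlonglongrightarrow> l"
    by (auto simp: Cauchy_convergent_iff convergent_def)
  have "l \<in> S"
    using S(2) y(1) l closed_sequentially by blast
  have "(norm (x - l))\<^sup>2 \<le> d\<^sup>2 + 0"
    using y(2) less_imp_le
    by (intro LIMSEQ_le[of "\<lambda>k. (norm (x - y k))\<^sup>2" _ "\<lambda>k. d\<^sup>2 + 1 / real (Suc k)"]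
        tendsto_intros l LIMSEQ_Suc[OF lim_1_over_n]) blast
  then have "norm (x - l) \<le> d"
    using d(1) by - (rule power2_le_imp_le, simp_all)
  then show ?thesis
    using d(2) \<open>l \<in> S\<close> by (blast intro: order_trans)
qed

text \<open>If the residual \<open>x - y\<close> of a nearest point had a component along some
  \<open>z\<close> in \<open>S\<close>, moving \<open>y\<close> by that component would give a
  closer point of \<open>S\<close>.\<close>

lemma orth_decomposition:
  assumes "closed_subspace scl S"
  shows "\<exists>y\<in>S. x - y \<in> orth_compl ip S"
proof -
  have S: "subspace S"
    using assms by (simp add: closed_subspace_def)
  obtain y where y: "y \<in> S" "\<And>z. z \<in> S \<Longrightarrow> norm (x - y) \<le> norm (x - z)"
    using nearest_point_exists[OF assms] by blast
  have "ip (x - y) z = 0" if "z \<in> S" for z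
  proof (cases "z = 0")
    case False
    let ?c = "ip (x - y) z / ip z z"
    have "y + scl ?c z \<in> S"
      using S y(1) that by (intro subspace_add subspace_scale)
    then have "norm (x - y) \<le> norm (x - y - scl ?c z)"
      using y(2) by (simp add: diff_diff_eq)
    then have "(norm (x - y))\<^sup>2 \<le> (norm (x - y - scl ?c z))\<^sup>2"
      by (simp add: power_mono)
    then show ?thesis
      using norm_minus_component[OF False, of "x - y"] False by simp
  qed simp
  then show ?thesis
    using y(1) by (auto simp: orth_compl_def)
qed

lemma orth_proj_eqI:
  assumes "subspace S" "y \<in> S" "x - y \<in> orth_compl ip S"
  shows "orth_proj ip S x = y"
  unfolding orth_proj_def
proof (rule the_equality)
  fix z assume z: "z \<in> S \<and> x - z \<in> orth_compl ip S"
  then have "(x - y) - (x - z) \<in> orth_compl ip S"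
    using assms(3) subspace_orth_compl subspace_diff by blast
  moreover have "z - y \<in> S"
    using z assms(1,2) subspace_diff by blast
  ultimately have "ip (z - y) (z - y) = 0"
    by (simp add: orth_compl_def)
  then show "z = y"
    by simp
qed (use assms in simp)

text \<open>The decomposition along \<open>S\<close> serves for its complement as well: since
  \<open>S\<close> lies in its double complement, the residual \<open>x - y\<close> fits the
  description of the projection.\<close>

lemma orth_proj_orth_compl:
  assumes "closed_subspace scl S"
  shows "orth_proj ip (orth_compl ip S) x \<in> orth_compl ip S"
    and "x - orth_proj ip (orth_compl ip S) x \<in> orth_compl ip (orth_compl ip S)"
proof -
  obtain y where y: "y \<in> S" "x - y \<in> orth_compl ip S"
    using orth_decomposition[OF assms] by blast
  moreover have "y \<in> orth_compl ip (orth_compl ip S)"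
    using y(1) ip_commute_zero by (auto simp: orth_compl_def)
  ultimately have "orth_proj ip (orth_compl ip S) x = x - y"
    by (intro orth_proj_eqI subspace_orth_compl) auto
  then show "orth_proj ip (orth_compl ip S) x \<in> orth_compl ip S"
    and "x - orth_proj ip (orth_compl ip S) x \<in> orth_compl ip (orth_compl ip S)"
    using y \<open>y \<in> orth_compl ip (orth_compl ip S)\<close> by simp_all
qed

text \<open>Uniqueness of the decomposition reduces linearity to checking that the expected values
  pass the test of \<open>orth_proj_eqI\<close>.\<close>

lemma linear_orth_proj_orth_compl:
  assumes "closed_subspace scl S"
  shows "Vector_Spaces.linear scl scl (orth_proj ip (orth_compl ip S))"
proof -
  let ?P = "orth_proj ip (orth_compl ip S)"
  note P = orth_proj_orth_compl[OF assms]
  have "?P (x + y) = ?P x + ?P y" for x y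
  proof (intro orth_proj_eqI subspace_orth_compl subspace_add P)
    have "(x - ?P x) + (y - ?P y) \<in> orth_compl ip (orth_compl ip S)"
      by (intro subspace_add[OF subspace_orth_compl] P)
    then show "x + y - (?P x + ?P y) \<in> orth_compl ip (orth_compl ip S)"
      by (simp add: algebra_simps)
  qed
  moreover have "?P (scl c x) = scl c (?P x)" for c x
    by (intro orth_proj_eqI subspace_orth_compl subspace_scale P)
      (metis P(2) scale_right_diff_distrib subspace_orth_compl subspace_scale)
  ultimately show ?thesis
    by (simp add: Vector_Spaces.linear_iff vector_space_axioms)
qed

section \<open>Infinite-dimensional subspaces under finitely many orthogonality conditions\<close>

lemma infinite_dimensional_Int_hyperplane:
  assumes S: "subspace S" and inf: "\<not> finite_dimensional scl S"
  shows "\<not> finite_dimensional scl {x \<in> S. ip x g = 0}"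
proof
  let ?S0 = "{x \<in> S. ip x g = 0}"
  assume "finite_dimensional scl ?S0"
  then obtain E where E: "finite E" "?S0 = span E"
    by (auto simp: finite_dimensional_def)
  show False
  proof (cases "\<exists>s\<in>S. ip s g \<noteq> 0")
    case True
    then obtain s where s: "s \<in> S" "ip s g \<noteq> 0"
      by blast
    \<comment> \<open>The hyperplane section has codimension one in \<open>S\<close>, so a single
      vector \<open>s\<close> off it completes a finite spanning set.\<close>
    have "S = span (insert s E)"
    proof (intro equalityI subsetI)
      fix x assume "x \<in> S"
      then have "x - scl (ip x g / ip s g) s \<in> ?S0"
        using s S by (simp add: subspace_diff subspace_scale ip_minus_left ip_scale_left)
      then show "x \<in> span (insert s E)"
        unfolding E(2) span_insert by blast
    next
      fix x assume "x \<in> span (insert s E)"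
      then obtain k where "x - scl k s \<in> ?S0"
        unfolding E(2) span_insert by blast
      then have "(x - scl k s) + scl k s \<in> S"
        using s(1) S by (intro subspace_add subspace_scale) auto
      then show "x \<in> S"
        by simp
    qed
    then show False
      using inf E(1) by (auto simp: finite_dimensional_def)
  next
    case False
    then have "?S0 = S"
      by auto
    then show False
      using inf E by (auto simp: finite_dimensional_def)
  qed
qed

text \<open>Each condition passes to a hyperplane section and preserves infinite dimension, so a
  nonzero vector survives. This supplies the directions \<open>u\<close> and \<open>w\<close> of the
  two perturbations.\<close>

lemma exists_orthogonal_to_finite:
  assumes "finite G" "subspace S" "\<not> finite_dimensional scl S"
  shows "\<exists>w\<in>S. w \<noteq> 0 \<and> (\<forall>g\<in>G. ip w g = 0)"
proof -
  have "subspace {x \<in> S. \<forall>g\<in>G. ip x g = 0} \<and> \<not> finite_dimensional scl {x \<in> S. \<forall>g\<in>G. ip x g = 0}"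
    using assms
  proof (induction G)
    case (insert g G)
    let ?S = "{x \<in> S. \<forall>g\<in>G. ip x g = 0}"
    have "{x \<in> S. \<forall>h\<in>insert g G. ip x h = 0} = {x \<in> ?S. ip x g = 0}"
      by auto
    moreover have "subspace {x \<in> ?S. ip x g = 0}"
      using insert by (auto simp: subspace_def ip_add_left ip_scale_left)
    ultimately show ?case
      using insert infinite_dimensional_Int_hyperplane[of ?S g] by simp
  qed simp
  \<comment> \<open>The zero space is the span of the empty set, hence finite-dimensional, so the
    remaining subspace is larger.\<close>
  then have "{x \<in> S. \<forall>g\<in>G. ip x g = 0} \<noteq> span {}" "0 \<in> {x \<in> S. \<forall>g\<in>G. ip x g = 0}"
    using subspace_0 by (metis finite.emptyI finite_dimensional_def, blast)
  then show ?thesis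
    unfolding span_empty by blast
qed

end

section \<open>Rank one operators, the space of field-linear operators, and strong closure\<close>

lemma rank_one_operator:
  assumes H: "hilbert_space scaleH ipH" and K: "hilbert_space scaleK ipK"
  obtains R where "R \<in> bounded_operators scaleH scaleK"
    and "\<And>x. blinfun_apply R x = scaleK (ipH x u) w"
proof -
  interpret H: hilbert_space scaleH ipH by fact
  interpret K: hilbert_space scaleK ipK by fact
  have "bounded_linear (\<lambda>x. scaleK (ipH x u) w)"
  proof (rule bounded_linear_intro[where K = "norm u * norm w"])
    fix r x
    show "scaleK (ipH (r *\<^sub>R x) u) w = r *\<^sub>R scaleK (ipH x u) w"
      by (simp add: H.ip_scale_left flip: H.scale_of_real K.scale_of_real)
  next
    fix x
    show "norm (scaleK (ipH x u) w) \<le> norm x * (norm u * norm w)"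
      using mult_right_mono[OF H.Cauchy_Schwarz[of x u], of "norm w"]
      by (simp add: K.norm_scale mult.assoc)
  qed (simp add: H.ip_add_left K.scale_left_distrib)
  then have "blinfun_apply (Blinfun (\<lambda>x. scaleK (ipH x u) w)) = (\<lambda>x. scaleK (ipH x u) w)"
    by (rule bounded_linear_Blinfun_apply)
  then show thesis
    by (intro that[of "Blinfun (\<lambda>x. scaleK (ipH x u) w)"])
      (simp_all add: bounded_operators_def Vector_Spaces.linear_iff H.vector_space_axioms
        K.vector_space_axioms H.ip_add_left H.ip_scale_left K.scale_left_distrib)
qed

lemma bounded_operators_add:
  "S \<in> bounded_operators s t \<Longrightarrow> T \<in> bounded_operators s t \<Longrightarrow> S + T \<in> bounded_operators s t"
  by (simp add: bounded_operators_def Vector_Spaces.linear_iff blinfun.add_left add_ac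
      vector_space.vector_space_assms)

lemma bounded_operators_diff:
  assumes "S \<in> bounded_operators s t" "T \<in> bounded_operators s t"
  shows "S - T \<in> bounded_operators s t"
proof -
  from assms interpret t: vector_space t
    by (simp add: bounded_operators_def Vector_Spaces.linear_iff)
  show ?thesis
    using assms by (simp add: bounded_operators_def Vector_Spaces.linear_iff blinfun.diff_left
        t.scale_right_diff_distrib)
qed

lemma bounded_operators_compose:
  "S \<in> bounded_operators t u \<Longrightarrow> T \<in> bounded_operators s t \<Longrightarrow> S o\<^sub>L T \<in> bounded_operators s u"
  by (simp add: bounded_operators_def Vector_Spaces.linear_iff)

text \<open>The strong topology is pulled back from the product topology, whose basic open sets
  restrict finitely many coordinates; one radius \<open>e\<close> then works for all of
  them.\<close>

lemma in_sot_closureI: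
  assumes T: "T \<in> bounded_operators scaleH scaleK" and A: "A \<subseteq> bounded_operators scaleH scaleK"
    and approx: "\<And>F e. finite F \<Longrightarrow> 0 < e \<Longrightarrow>
      \<exists>S\<in>A. \<forall>x\<in>F. dist (blinfun_apply S x) (blinfun_apply T x) < e"
  shows "T \<in> sot scaleH scaleK closure_of A"
  unfolding in_closure_of
proof (intro conjI allI impI)
  show "T \<in> topspace (sot scaleH scaleK)"
    using T by (simp add: sot_def topspace_subtopology strong_operator_topology_topspace)
next
  fix U assume U: "T \<in> U \<and> openin (sot scaleH scaleK) U"
  then obtain W where W: "openin strong_operator_topology W" "U = W \<inter> bounded_operators scaleH scaleK"
    by (auto simp: sot_def openin_subtopology)
  then obtain V where V: "open V" "W = blinfun_apply -` V"
    by (auto simp: strong_operator_topology_def openin_pullback_topology)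
  then obtain X where X: "blinfun_apply T \<in> PiE UNIV X" "\<And>i. open (X i)"
    "finite {i. X i \<noteq> UNIV}" "PiE UNIV X \<subseteq> V"
    using product_topology_open_contains_basis[of "\<lambda>_. euclidean" UNIV V "blinfun_apply T"] U W
    unfolding open_fun_def by auto
  let ?F = "{i. X i \<noteq> UNIV}"
  have "\<exists>e>0. ball (blinfun_apply T i) e \<subseteq> X i" for i
    using X(1,2) by (meson PiE_mem UNIV_I open_contains_ball)
  then obtain r where r: "\<And>i. 0 < r i" "\<And>i. ball (blinfun_apply T i) (r i) \<subseteq> X i"
    by metis
  \<comment> \<open>The inserted 1 keeps the minimum defined and positive when no coordinate is
    restricted.\<close>
  define e where "e = Min (insert 1 (r ` ?F))"
  have "0 < e"
    using X(3) r(1) by (simp add: e_def)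
  then obtain S where S: "S \<in> A" "\<And>x. x \<in> ?F \<Longrightarrow> dist (blinfun_apply S x) (blinfun_apply T x) < e"
    using approx[OF X(3)] by blast
  have "blinfun_apply S i \<in> X i" for i
  proof (cases "i \<in> ?F")
    case True
    then have "e \<le> r i"
      using X(3) by (simp add: e_def)
    then show ?thesis
      using S(2)[OF True] r(2)[of i] by (auto simp: dist_commute)
  qed simp
  then have "S \<in> U"
    using X(4) V(2) W(2) S(1) A by auto
  then show "\<exists>S. S \<in> A \<and> S \<in> U"
    using S(1) by blast
qed

section \<open>Obstructions to complementability\<close>

lemma projection_onto_fixes:
  assumes "projection_onto scl S P" "x \<in> S"
  shows "blinfun_apply P x = x"
proof -
  obtain y where "x = blinfun_apply P y" "P o\<^sub>L P = P"
    using assms by (auto simp: projection_onto_def)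
  then show ?thesis
    by (metis blinfun_apply_blinfun_compose)
qed

lemma projection_onto_mem: "projection_onto scl S P \<Longrightarrow> blinfun_apply P x \<in> S"
  by (auto simp: projection_onto_def)

text \<open>\<open>Ml\<close> factors through \<open>I - Pl\<close> and so kills every vector fixed
  by \<open>Pl\<close>, whereas the last equation makes \<open>Ml\<close> fix every value of
  \<open>T (I - Pr)\<close>. A nonzero \<open>n\<close> cannot be of both kinds.\<close>

lemma not_complementable_mapsto_range:
  assumes "blinfun_apply Pl n = n" "n \<noteq> 0" "blinfun_apply T (x - blinfun_apply Pr x) = n"
  shows "\<not> complementable scaleH scaleK Pr Pl T"
proof
  assume "complementable scaleH scaleK Pr Pl T"
  then obtain Ml where Ml: "Ml o\<^sub>L (id_blinfun - Pl) = Ml"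
    "Ml o\<^sub>L T o\<^sub>L (id_blinfun - Pr) = T o\<^sub>L (id_blinfun - Pr)"
    by (auto simp: complementable_def)
  have "n = blinfun_apply (Ml o\<^sub>L T o\<^sub>L (id_blinfun - Pr)) x"
    unfolding Ml(2) using assms(3) by (simp add: blinfun.diff_left)
  also have "\<dots> = blinfun_apply (Ml o\<^sub>L (id_blinfun - Pl)) n"
    unfolding Ml(1) using assms(3) by (simp add: blinfun.diff_left)
  also have "\<dots> = 0"
    using assms(1) by (simp add: blinfun.diff_left)
  finally show False
    using assms(2) by simp
qed

text \<open>For \<open>Pl = 0\<close> the second equation reads \<open>T Mr = T\<close>, and
  \<open>Mr\<close> takes its values in the range of \<open>I - Pr\<close>; so
  \<open>y = Mr x\<close> is a witness.\<close>

lemma complementable_range: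
  assumes "complementable scaleH scaleK Pr 0 T"
  shows "\<exists>y. blinfun_apply T x = blinfun_apply T (y - blinfun_apply Pr y)"
proof -
  obtain Mr where Mr: "(id_blinfun - Pr) o\<^sub>L Mr = Mr" "id_blinfun o\<^sub>L T o\<^sub>L Mr = id_blinfun o\<^sub>L T"
    using assms by (auto simp: complementable_def)
  have "blinfun_apply T x = blinfun_apply (id_blinfun o\<^sub>L T o\<^sub>L Mr) x"
    unfolding Mr(2) by simp
  also have "\<dots> = blinfun_apply T (blinfun_apply ((id_blinfun - Pr) o\<^sub>L Mr) x)"
    unfolding Mr(1) by simp
  finally show ?thesis
    by (auto simp: blinfun.diff_left)
qed

section \<open>Perturbations into noncomplementable operators\<close>

lemma approx_noncomplementable_nontrivial:
  assumes H: "hilbert_space scaleH ipH" and K: "hilbert_space scaleK ipK"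
    and T: "T \<in> bounded_operators scaleH scaleK"
    and Pr: "projection_onto scaleH M Pr" and Pl: "projection_onto scaleK N Pl"
    and n: "n \<in> N" "n \<noteq> 0"
    and inf: "\<not> finite_dimensional scaleH (orth_compl ipH M)" and F: "finite F"
  shows "\<exists>S\<in>bounded_operators scaleH scaleK - psi scaleH scaleK Pr Pl.
    \<forall>x\<in>F. blinfun_apply S x = blinfun_apply T x"
proof -
  interpret H: hilbert_space scaleH ipH by fact
  interpret K: hilbert_space scaleK ipK by fact
  obtain u where u: "u \<in> orth_compl ipH M" "u \<noteq> 0" "\<And>x. x \<in> F \<Longrightarrow> ipH u x = 0"
    using H.exists_orthogonal_to_finite[OF F H.subspace_orth_compl inf] by blast
  define v where "v = u - blinfun_apply Pr u"
  \<comment> \<open>The vector is scaled so that \<open>R v = T v - n\<close>, because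
    \<open>ipH v u\<close> will turn out to be \<open>ipH u u\<close>.\<close>
  obtain R where R: "R \<in> bounded_operators scaleH scaleK" "\<And>x. blinfun_apply R x =
      scaleK (ipH x u) (scaleK (1 / ipH u u) (blinfun_apply T v - n))"
    using rank_one_operator[OF H K] by blast
  \<comment> \<open>\<open>Pr\<close> may be oblique, but its values lie in \<open>M\<close>, to
    which \<open>u\<close> is orthogonal; so \<open>v\<close> and \<open>u\<close> have the same
    component along \<open>u\<close>.\<close>
  have "ipH u (blinfun_apply Pr u) = 0"
    using u(1) projection_onto_mem[OF Pr] by (auto simp: orth_compl_def)
  then have "ipH v u = ipH u u"
    using H.ip_commute_zero by (simp add: v_def H.ip_minus_left)
  then have "blinfun_apply (T - R) v = n"
    using u(2) by (simp add: blinfun.diff_left R(2))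
  then have "\<not> complementable scaleH scaleK Pr Pl (T - R)"
    unfolding v_def by (rule not_complementable_mapsto_range[OF projection_onto_fixes[OF Pl n(1)] n(2)])
  moreover have "blinfun_apply (T - R) x = blinfun_apply T x" if "x \<in> F" for x
    using u(3)[OF that] H.ip_commute_zero by (simp add: blinfun.diff_left R(2))
  ultimately show ?thesis
    using bounded_operators_diff[OF T R(1)] by (auto simp: psi_def)
qed

text \<open>If the projection onto \<open>N\<close> vanishes, complementability only says that \<open>T\<close> and its
  restriction to the kernel of \<open>Pr\<close> have the same range. The perturbation pushes the range of the
  restriction into a hyperplane orthogonal to \<open>w\<close> and moves \<open>T m\<close> out of it.\<close>

lemma approx_noncomplementable_trivial:
  assumes H: "hilbert_space scaleH ipH" and K: "hilbert_space scaleK ipK"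
    and T: "T \<in> bounded_operators scaleH scaleK"
    and Pr: "projection_onto scaleH M Pr" and m: "m \<in> M" "m \<noteq> 0"
    and S: "module.subspace scaleK S" "\<not> finite_dimensional scaleK S"
    and F: "finite F" and e: "0 < e"
  shows "\<exists>S\<in>bounded_operators scaleH scaleK - psi scaleH scaleK Pr 0.
    \<forall>x\<in>F. dist (blinfun_apply S x) (blinfun_apply T x) < e"
proof -
  interpret H: hilbert_space scaleH ipH by fact
  interpret K: hilbert_space scaleK ipK by fact
  define Q where "Q x = x - blinfun_apply Pr x" for x
  \<comment> \<open>Orthogonality of \<open>w\<close> to \<open>T (Q x)\<close> for \<open>x\<close>
    in \<open>F\<close> makes \<open>R\<close> vanish there; orthogonality to \<open>T m\<close>
    leaves the component of \<open>T' m\<close> along \<open>w\<close> to \<open>D\<close>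
    alone.\<close>
  have "finite (insert (blinfun_apply T m) ((\<lambda>x. blinfun_apply T (Q x)) ` F))"
    using F by simp
  from K.exists_orthogonal_to_finite[OF this S]
  obtain w where w: "w \<noteq> 0" "ipK w (blinfun_apply T m) = 0"
    "\<And>x. x \<in> F \<Longrightarrow> ipK w (blinfun_apply T (Q x)) = 0"
    by blast
  \<comment> \<open>\<open>d * b x\<close> will be the norm of \<open>D (Pr x)\<close>, the only
    change at a vector \<open>x\<close> of \<open>F\<close>. The 1 in the denominator of
    \<open>d\<close> rules out division by zero and makes the bound strict.\<close>
  define b where "b x = norm (ipH (blinfun_apply Pr x) m) * norm w" for x
  define d where "d = e / (1 + (\<Sum>x\<in>F. b x))"
  have "0 \<le> (\<Sum>x\<in>F. b x)"
    by (simp add: b_def sum_nonneg)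
  then have d: "0 < d"
    using e by (simp add: d_def)
  have db: "d * b x < e" if "x \<in> F" for x
  proof -
    have "b x \<le> (\<Sum>x\<in>F. b x)"
      using that F by (intro member_le_sum) (auto simp: b_def)
    then have "b x < 1 + (\<Sum>x\<in>F. b x)"
      by simp
    then show ?thesis
      using mult_strict_left_mono[OF _ e] \<open>0 \<le> (\<Sum>x\<in>F. b x)\<close>
      by (simp add: d_def pos_divide_less_eq)
  qed
  \<comment> \<open>\<open>R\<close> is the orthogonal projection onto the line through
    \<open>w\<close>.\<close>
  obtain R where R: "R \<in> bounded_operators scaleK scaleK"
    "\<And>y. blinfun_apply R y = scaleK (ipK y w) (scaleK (1 / ipK w w) w)"
    using rank_one_operator[OF K K] by blast
  obtain D where D: "D \<in> bounded_operators scaleH scaleK"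
    "\<And>x. blinfun_apply D x = scaleK (ipH x m) (d *\<^sub>R w)"
    using rank_one_operator[OF H K] by blast
  \<comment> \<open>On the kernel of \<open>Pr\<close> the \<open>R\<close> term removes the
    component along \<open>w\<close> and the \<open>D\<close> term vanishes; on \<open>M\<close> the
    \<open>R\<close> term vanishes and only \<open>D\<close> is added.\<close>
  define T' where "T' = T - (R o\<^sub>L T o\<^sub>L (id_blinfun - Pr)) + (D o\<^sub>L Pr)"
  have T'_apply: "blinfun_apply T' x = blinfun_apply T x - blinfun_apply R (blinfun_apply T (Q x))
      + blinfun_apply D (blinfun_apply Pr x)" for x
    by (simp add: T'_def Q_def blinfun.diff_left blinfun.add_left)
  have PrQ: "blinfun_apply Pr (Q x) = 0" for x
    using projection_onto_fixes[OF Pr projection_onto_mem[OF Pr]]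
    by (simp add: Q_def blinfun.diff_right)
  have ops: "id_blinfun \<in> bounded_operators scaleH scaleH" "Pr \<in> bounded_operators scaleH scaleH"
    using Pr by (auto simp: projection_onto_def bounded_operators_def Vector_Spaces.linear_iff
        H.vector_space_axioms)
  have "R o\<^sub>L T o\<^sub>L (id_blinfun - Pr) \<in> bounded_operators scaleH scaleK"
    by (rule bounded_operators_compose[OF bounded_operators_compose[OF R(1) T]
          bounded_operators_diff[OF ops]])
  moreover have "D o\<^sub>L Pr \<in> bounded_operators scaleH scaleK"
    by (rule bounded_operators_compose[OF D(1) ops(2)])
  ultimately have bdd: "T' \<in> bounded_operators scaleH scaleK"
    unfolding T'_def by (intro bounded_operators_add bounded_operators_diff T)
  have perp: "ipK (blinfun_apply T' (Q x)) w = 0" for x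
  proof -
    have "Q (Q x) = Q x"
      using PrQ[of x] by (simp add: Q_def[of "Q x"])
    then show ?thesis
      using w(1) PrQ[of x]
      by (simp add: T'_apply R(2) D(2) K.ip_minus_left K.ip_add_left K.ip_scale_left blinfun.zero_right)
  qed
  have Tm: "blinfun_apply T' m = blinfun_apply T m + scaleK (ipH m m) (d *\<^sub>R w)"
    using projection_onto_fixes[OF Pr m(1)]
    by (simp add: T'_apply R(2) D(2) Q_def blinfun.zero_right)
  have "ipK (blinfun_apply T' m) w = ipH m m * (of_real d * ipK w w)"
    using w(2) K.ip_commute_zero
    by (simp add: Tm K.ip_add_left K.ip_scale_left flip: K.scale_of_real)
  then have "ipK (blinfun_apply T' m) w \<noteq> 0"
    using m(2) w(1) d by simp
  \<comment> \<open>Otherwise \<open>T' m\<close> would equal \<open>T' (Q y)\<close> for some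
    \<open>y\<close> and hence be orthogonal to \<open>w\<close>.\<close>
  then have "\<not> complementable scaleH scaleK Pr 0 T'"
    using complementable_range[of scaleH scaleK Pr T' m] perp by (auto simp: Q_def)
  moreover have "dist (blinfun_apply T' x) (blinfun_apply T x) < e" if "x \<in> F" for x
  proof -
    have "ipK (blinfun_apply T (Q x)) w = 0"
      using w(3)[OF that] K.ip_commute_zero by blast
    then have "dist (blinfun_apply T' x) (blinfun_apply T x) = d * b x"
      using d by (simp add: dist_norm T'_apply R(2) D(2) K.norm_scale b_def)
    then show ?thesis
      using db[OF that] by simp
  qed
  ultimately show ?thesis
    using bdd by (auto simp: psi_def)
qed

theorem theorem3p13:
  fixes scaleH :: "'f::rc_scalar \<Rightarrow> 'h::banach \<Rightarrow> 'h" and ipH :: "'h \<Rightarrow> 'h \<Rightarrow> 'f"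
    and scaleK :: "'f \<Rightarrow> 'k::banach \<Rightarrow> 'k" and ipK :: "'k \<Rightarrow> 'k \<Rightarrow> 'f"
    and M :: "'h set" and N :: "'k set"
    and Pr :: "'h \<Rightarrow>\<^sub>L 'h" and Pl :: "'k \<Rightarrow>\<^sub>L 'k" and T :: "'h \<Rightarrow>\<^sub>L 'k"
  assumes "hilbert_space scaleH ipH" and "hilbert_space scaleK ipK"
    and "closed_subspace scaleH M" and "closed_subspace scaleK N"
    and "M \<noteq> {0} \<or> N \<noteq> {0}"
    and "projection_onto scaleH M Pr" and "projection_onto scaleK N Pl"
    and "T \<in> psi scaleH scaleK Pr Pl"
    and "finite_dimensional scaleK (block ipK M (orth_compl ipK N) T ` M)"
    and "\<not> finite_dimensional scaleK
           (block ipK (orth_compl ipH M) (orth_compl ipK N) T ` orth_compl ipH M)"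
  shows "T \<in> sot scaleH scaleK frontier_of
           (bounded_operators scaleH scaleK - psi scaleH scaleK Pr Pl)"
proof -
  interpret H: hilbert_space scaleH ipH by fact
  interpret K: hilbert_space scaleK ipK by fact
  let ?A = "bounded_operators scaleH scaleK - psi scaleH scaleK Pr Pl"
  let ?D = "\<lambda>x. orth_proj ipK (orth_compl ipK N) (blinfun_apply T x)"
  have T: "T \<in> bounded_operators scaleH scaleK"
    using assms(8) by (simp add: psi_def)
  \<comment> \<open>As a homomorphism over the field, \<open>?D\<close> maps subspaces to subspaces
    and spans to spans.\<close>
  have "module_hom scaleH scaleK ?D"
    using T K.linear_orth_proj_orth_compl[OF assms(4)]
    by (simp add: module_hom_iff_linear bounded_operators_def Vector_Spaces.linear_iff)
  then interpret D: module_hom scaleH scaleK ?D .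
  have inf: "\<not> finite_dimensional scaleK (?D ` orth_compl ipH M)"
    using assms(10) by (simp add: block_def)
  have "T \<in> sot scaleH scaleK closure_of ?A"
  proof (rule in_sot_closureI[OF T])
    fix F :: "'h set" and e :: real
    assume F: "finite F" and e: "0 < e"
    show "\<exists>S\<in>?A. \<forall>x\<in>F. dist (blinfun_apply S x) (blinfun_apply T x) < e"
    proof (cases "N = {0}")
      case True
      then have "Pl = 0"
        using projection_onto_mem[OF assms(7)] by (intro blinfun_eqI) simp
      obtain m where "m \<in> M" "m \<noteq> 0"
        using True assms(3,5) H.subspace_0 by (auto simp: closed_subspace_def)
      \<comment> \<open>The image of the complement of \<open>M\<close> under \<open>?D\<close> is
        the infinite-dimensional subspace in which \<open>w\<close> is found.\<close>
      then show ?thesis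
        unfolding \<open>Pl = 0\<close> using F e inf
        by (intro approx_noncomplementable_trivial[OF assms(1,2) T assms(6),
              where S = "?D ` orth_compl ipH M"] D.subspace_image H.subspace_orth_compl)
    next
      case False
      then obtain n where "n \<in> N" "n \<noteq> 0"
        using assms(4) K.subspace_0 by (auto simp: closed_subspace_def)
      \<comment> \<open>A finite spanning set of the complement would be mapped by \<open>?D\<close>
        to one of its image.\<close>
      moreover have "\<not> finite_dimensional scaleH (orth_compl ipH M)"
        using inf D.span_image by (metis finite_dimensional_def finite_imageI)
      ultimately show ?thesis
        using approx_noncomplementable_nontrivial[OF assms(1,2) T assms(6,7) _ _ _ F] e
        by (metis dist_self)
    qed
  qed simp
  \<comment> \<open>\<open>T\<close> lies in \<open>psi\<close>, hence outside \<open>?A\<close> and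
    all the more outside its interior.\<close>
  moreover have "T \<notin> sot scaleH scaleK interior_of ?A"
    using assms(8) interior_of_subset[of "sot scaleH scaleK" ?A] by blast
  ultimately show ?thesis
    by (simp add: frontier_of_def)
qed

end
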